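(* Let $n\in\{p^{k},\,p^{k}q,\,p^{2}q^{2},\,pqr,\,p^{2}qr,\,pqrs : p,q,r,s \text{ are primes and } k\ge 1\}$, and let $S$ be an inverse-closed subset of $\mathbb{Z}_n\setminus\{0\}$ such that $\langle S\rangle=\mathbb{Z}_n$, $|S|$ divides $n$, and $|S|$ and $n/|S|$ are coprime. Then $\mathrm{Cay}(\mathbb{Z}_n,S)$ admits a total perfect code if and only if $s\not\equiv s'\pmod{|S|}$ for all distinct $s,s'\in S$.
   Context: Inverse-closed means $-S=S$. The Cayley graph $\mathrm{Cay}(\mathbb{Z}_n,S)$ has vertex set $\mathbb{Z}_n$, with $x,y$ adjacent iff $y-x\in S$. A total perfect code in a graph is a set $C$ of vertices such that every vertex of the graph (including those in $C$) is adjacent to exactly one vertex of $C$. *)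

theory Defs
  imports
    "HOL-Algebra.Elementary_Groups"
    "HOL-Number_Theory.Cong"
    "Graph_Theory.Pair_Digraph"
begin

text \<open>Undirected graphs are symmetric digraphs. The connection condition \<open>y - x \<in> S\<close> is written
  in HOL-Algebra's multiplicative notation; for \<^term>\<open>integer_mod_group n\<close> the product is addition
  modulo \<^term>\<open>n\<close>.\<close>

definition cayley_graph :: "('a, 'b) monoid_scheme \<Rightarrow> 'a set \<Rightarrow> 'a pair_pre_digraph" where
  "cayley_graph G S =
     \<lparr>pverts = carrier G,
      parcs = {(x, y). x \<in> carrier G \<and> y \<in> carrier G \<and> y \<otimes>\<^bsub>G\<^esub> inv\<^bsub>G\<^esub> x \<in> S}\<rparr>"

lemma pair_graph_cayley_graph:
  assumes "group G" and "finite (carrier G)"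
    and S: "S \<subseteq> carrier G - {\<one>\<^bsub>G\<^esub>}" and inv: "set_inv\<^bsub>G\<^esub> S = S"
  shows "pair_graph (cayley_graph G S)"
proof -
  interpret group G by fact
  have "parcs (cayley_graph G S) \<subseteq> carrier G \<times> carrier G"
    by (auto simp: cayley_graph_def)
  then have fin: "finite (parcs (cayley_graph G S))"
    using assms(2) by (meson finite_SigmaI finite_subset)
  have "x \<otimes>\<^bsub>G\<^esub> inv\<^bsub>G\<^esub> y \<in> S"
    if "x \<in> carrier G" "y \<in> carrier G" "y \<otimes>\<^bsub>G\<^esub> inv\<^bsub>G\<^esub> x \<in> S" for x y
  proof -
    have "inv\<^bsub>G\<^esub> (y \<otimes>\<^bsub>G\<^esub> inv\<^bsub>G\<^esub> x) \<in> S"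
      using inv that(3) by (auto simp: SET_INV_def)
    then show ?thesis
      using that by (simp add: inv_mult_group)
  qed
  then show ?thesis
    using S fin assms(2)
    by unfold_locales (auto simp: cayley_graph_def symmetric_def sym_def)
qed

definition total_perfect_code :: "('a, 'b) pre_digraph \<Rightarrow> 'a set \<Rightarrow> bool" where
  "total_perfect_code G C \<longleftrightarrow>
     C \<subseteq> verts G \<and> (\<forall>v \<in> verts G. \<exists>!c. c \<in> C \<and> v \<rightarrow>\<^bsub>G\<^esub> c)"

end

theory Submission
  imports Defs "HOL-Library.Poly_Mapping"
begin

text \<open>
  A total perfect code \<open>C\<close> of the circulant graph on \<open>\<int>\<^sub>n\<close> with connection set \<open>S\<close> is the same as
  a tiling of \<open>\<int>\<^sub>n\<close> with the two factors \<open>C\<close> and \<open>- S\<close>: every \<open>v\<close> is \<open>c - s\<close> for exactly one pair \<open>c \<in> C\<close>,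
  \<open>s \<in> S\<close>. Write \<open>m = |S|\<close> and \<open>n = m l\<close>, so that \<open>|C| = l\<close> is coprime to \<open>m\<close>.

  If the elements of \<open>S\<close> are distinct modulo \<open>m\<close>, they form a complete residue system modulo \<open>m\<close>,
  and the multiples of \<open>m\<close> are a code (lemma \<open>multiples_tile_of_inj_mod\<close>).

  The converse rests on a replacement principle due to Tijdeman (lemma \<open>tiling_dilate\<close>): in a
  tiling, one factor \<open>C\<close> may be replaced by its dilate \<open>k C\<close> for any \<open>k > 0\<close> coprime to \<open>|C|\<close>. It is
  enough to treat a prime \<open>k = p\<close>. In the group ring, \<open>C(X)\<^sup>p\<close> is congruent to \<open>C(X\<^sup>p)\<close> modulo \<open>p\<close>.
  Applied to the other factor, \<open>C(X)\<close> gives the constant 1, hence \<open>C(X)\<^sup>p\<close> gives the constant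
  \<open>|C| ^ (p - 1)\<close>, which is prime to \<open>p\<close>. So the dilate covers every residue at least once, and
  as it covers \<open>n\<close> residues counted with multiplicity, it covers each of them exactly once.

  Now take \<open>k = m\<close>. The dilate \<open>m C\<close> lives inside the subgroup \<open>m \<int>\<^sub>n\<close> of order \<open>l = |C|\<close>. Counting in
  a single coset of this subgroup shows that each coset meets \<open>S\<close> in exactly one element, which
  says that \<open>S\<close> is injective modulo \<open>m\<close> (lemma \<open>coprime_tiling_inj_mod\<close>).
\<close>

section \<open>Powers modulo a prime\<close>

text \<open>The binomial coefficients strictly between the two ends are divisible by \<open>p\<close>. The
  congruence is phrased as a divisibility because the ring to which it is applied, the integral
  group ring of \<open>\<int>\<close>, has characteristic zero.\<close>

lemma prime_dvd_power_add_diff: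
  fixes x y :: "'a :: comm_ring_1"
  assumes p: "prime p"
  shows "of_nat p dvd (x + y) ^ p - (x ^ p + y ^ p)"
proof -
  have p0: "p \<noteq> 0"
    using p by auto
  have set: "{..p} = insert 0 (insert p {0<..<p})"
    using p0 by auto
  have "(x + y) ^ p = (\<Sum>k\<le>p. of_nat (p choose k) * x ^ k * y ^ (p - k))"
    by (rule binomial_ring)
  also have "\<dots> = y ^ p + x ^ p + (\<Sum>k\<in>{0<..<p}. of_nat (p choose k) * x ^ k * y ^ (p - k))"
    unfolding set using p0 by simp
  finally have "(x + y) ^ p - (x ^ p + y ^ p)
      = (\<Sum>k\<in>{0<..<p}. of_nat (p choose k) * x ^ k * y ^ (p - k))"
    by simp
  moreover have "of_nat p dvd of_nat (p choose k) * x ^ k * y ^ (p - k)" if "k \<in> {0<..<p}" for k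
  proof -
    have "p dvd p choose k"
      by (rule dvd_choose_prime) (use that p in auto)
    then have "(of_nat p :: 'a) dvd of_nat (p choose k)"
      by (auto elim!: dvdE)
    then show ?thesis
      by (simp add: dvd_mult2)
  qed
  ultimately show ?thesis
    by (auto intro: dvd_sum)
qed

lemma prime_dvd_power_sum_diff:
  fixes x :: "'i \<Rightarrow> 'a :: comm_ring_1"
  assumes p: "prime p" and I: "finite I"
  shows "of_nat p dvd (\<Sum>i\<in>I. x i) ^ p - (\<Sum>i\<in>I. x i ^ p)"
  using I
proof (induction I rule: finite_induct)
  case empty
  then show ?case
    using p by (simp add: power_0_left prime_gt_0_nat)
next
  case (insert j I)
  have "of_nat p dvd ((x j + (\<Sum>i\<in>I. x i)) ^ p - (x j ^ p + (\<Sum>i\<in>I. x i) ^ p))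
      + ((\<Sum>i\<in>I. x i) ^ p - (\<Sum>i\<in>I. x i ^ p))"
    by (intro dvd_add prime_dvd_power_add_diff p insert.IH)
  then show ?case
    using insert.hyps by (simp add: algebra_simps)
qed

section \<open>The group ring of the integers\<close>

text \<open>An element \<open>P\<close> of the group ring is a finitely supported integer measure on \<open>\<int>\<close>, and
  \<open>pairing f P\<close> is the integral of \<open>f\<close> against it. Thus \<open>pairing (\<lambda>k. f (x + k)) P\<close>, as a function
  of \<open>x\<close>, is the result of letting \<open>P\<close> act on \<open>f\<close> by translations.\<close>

definition pairing :: "(int \<Rightarrow> int) \<Rightarrow> (int \<Rightarrow>\<^sub>0 int) \<Rightarrow> int" where
  "pairing f P = (\<Sum>k\<in>Poly_Mapping.keys P. Poly_Mapping.lookup P k * f k)"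

lemma pairing_superset:
  assumes "finite K" "Poly_Mapping.keys P \<subseteq> K"
  shows "pairing f P = (\<Sum>k\<in>K. Poly_Mapping.lookup P k * f k)"
  unfolding pairing_def
  by (rule sum.mono_neutral_left) (use assms in \<open>auto simp: in_keys_iff\<close>)

lemma pairing_0 [simp]: "pairing f 0 = 0"
  by (simp add: pairing_def)

lemma pairing_single [simp]: "pairing f (Poly_Mapping.single k c) = c * f k"
  by (simp add: pairing_def)

lemma pairing_add: "pairing f (P + Q) = pairing f P + pairing f Q"
proof -
  define K where "K = Poly_Mapping.keys P \<union> Poly_Mapping.keys Q"
  have K: "finite K" "Poly_Mapping.keys P \<subseteq> K" "Poly_Mapping.keys Q \<subseteq> K"
      "Poly_Mapping.keys (P + Q) \<subseteq> K"
    using keys_add[of P Q] by (auto simp: K_def)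
  show ?thesis
    using K by (simp add: pairing_superset lookup_add distrib_right sum.distrib)
qed

lemma pairing_diff: "pairing f (P - Q) = pairing f P - pairing f Q"
  using pairing_add[of f "P - Q" Q] by simp

lemma pairing_sum: "pairing f (\<Sum>i\<in>I. P i) = (\<Sum>i\<in>I. pairing f (P i))"
  by (induction I rule: infinite_finite_induct) (simp_all add: pairing_add)

lemma pairing_of_nat_mult: "pairing f (of_nat c * P) = int c * pairing f P"
  by (induction c) (simp_all add: pairing_add distrib_right)

text \<open>Multiplication by a group element becomes translation of the function. Both sides are additive in \<open>P\<close>, so it suffices to look at group elements \<open>P\<close>.\<close>

lemma pairing_frag_of_mult:
  "pairing f (frag_of a * P) = pairing (\<lambda>k. f (a + k)) P"
proof (rule frag_induction[of P UNIV])
  show "pairing f (frag_of a * (P - Q)) = pairing (\<lambda>k. f (a + k)) (P - Q)"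
    if "pairing f (frag_of a * P) = pairing (\<lambda>k. f (a + k)) P"
       "pairing f (frag_of a * Q) = pairing (\<lambda>k. f (a + k)) Q" for P Q
    using that by (simp add: right_diff_distrib pairing_diff)
qed (simp_all add: mult_single)

lemma frag_of_power: "frag_of (a :: int) ^ k = frag_of (int k * a)"
  by (induction k) (simp_all add: mult_single distrib_right flip: single_one)

text \<open>The first factor turns \<open>f\<close> into the constant 1, and each further factor multiplies a constant
  by the number of its summands.\<close>

lemma pairing_power_constant:
  fixes a :: "'i \<Rightarrow> int"
  assumes tile: "\<And>x. (\<Sum>i\<in>I. f (x + a i)) = 1"
  shows "pairing (\<lambda>k. f (x + k)) ((\<Sum>i\<in>I. frag_of (a i)) ^ Suc j) = int (card I) ^ j"
proof (induction j arbitrary: x)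
  case 0
  then show ?case
    by (simp add: pairing_sum tile)
next
  case (Suc j)
  let ?P = "\<Sum>i\<in>I. frag_of (a i)"
  have "pairing (\<lambda>k. f (x + k)) (?P ^ Suc (Suc j))
      = (\<Sum>i\<in>I. pairing (\<lambda>k. f (x + k)) (frag_of (a i) * ?P ^ Suc j))"
    by (simp add: sum_distrib_right pairing_sum power_Suc[of ?P "Suc j"] del: power_Suc)
  also have "\<dots> = (\<Sum>i\<in>I. int (card I) ^ j)"
    using Suc by (simp add: pairing_frag_of_mult flip: add.assoc)
  finally show ?case
    by simp
qed

section \<open>Dilating one factor of a tiling\<close>

text \<open>One factor of a tiling of \<open>\<int>\<^sub>n\<close> is given below by an \<open>n\<close>-periodic function \<open>f \<ge> 0\<close> (the
  indicator function of the factor, in the application), the other by an indexed family \<open>a\<close> of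
  integers. With a family, sums over a dilate \<open>k * a i\<close> count every element with its
  multiplicity even before it is known that these elements are distinct modulo \<open>n\<close>.\<close>

lemma sum_period_shift:
  fixes f :: "int \<Rightarrow> int"
  assumes n: "n > 0" and per: "\<And>x y. [x = y] (mod n) \<Longrightarrow> f x = f y"
  shows "(\<Sum>x\<in>{0..<n}. f (x + a)) = (\<Sum>x\<in>{0..<n}. f x)"
proof (rule sum.reindex_bij_witness[of _ "\<lambda>y. (y - a) mod n" "\<lambda>x. (x + a) mod n"])
  show "f ((x + a) mod n) = f (x + a)" for x
    by (rule per) (simp add: cong_def)
qed (use n in \<open>auto simp: mod_simps\<close>)

lemma sum_translates_period:
  fixes f :: "int \<Rightarrow> int"
  assumes n: "n > 0" and per: "\<And>x y. [x = y] (mod n) \<Longrightarrow> f x = f y"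
  shows "(\<Sum>x\<in>{0..<n}. \<Sum>i\<in>I. f (x + a i)) = int (card I) * (\<Sum>x\<in>{0..<n}. f x)"
proof -
  have "(\<Sum>x\<in>{0..<n}. f (x + a i)) = (\<Sum>x\<in>{0..<n}. f x)" for i
    using n per by (rule sum_period_shift)
  then show ?thesis
    by (subst sum.swap) simp
qed

text \<open>Let \<open>g x\<close> be the number of times that \<open>x\<close> is covered after dilation. By the congruence for
  \<open>p\<close>-th powers, \<open>g x\<close> is congruent to \<open>|I| ^ (p - 1)\<close> modulo \<open>p\<close> and therefore not zero. The sum
  of \<open>g\<close> over a period is not affected by the dilation and equals \<open>n\<close>, which leaves no room for
  values above 1.\<close>

lemma tiling_dilate_prime:
  fixes f :: "int \<Rightarrow> int" and a :: "'i \<Rightarrow> int"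
  assumes n: "n > 0" and per: "\<And>x y. [x = y] (mod n) \<Longrightarrow> f x = f y"
    and nonneg: "\<And>x. f x \<ge> 0"
    and tile: "\<And>x. (\<Sum>i\<in>I. f (x + a i)) = 1"
    and p: "prime p" and cop: "coprime p (card I)"
  shows "(\<Sum>i\<in>I. f (x + int p * a i)) = 1"
proof -
  have I: "finite I"
    \<comment> \<open>sums over infinite sets are 0\<close>
    using tile[of 0] by (metis sum.infinite zero_neq_one)
  define g where "g x = (\<Sum>i\<in>I. f (x + int p * a i))" for x
  have g_ge: "g x \<ge> 1" for x
  proof -
    let ?s = "\<lambda>i. frag_of (a i)"
    obtain R where R: "(\<Sum>i\<in>I. ?s i) ^ p - (\<Sum>i\<in>I. ?s i ^ p) = of_nat p * R"
      using prime_dvd_power_sum_diff[OF p I, of ?s] by (auto elim: dvdE)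
    have p_Suc: "Suc (p - 1) = p"
      using p by (simp add: prime_gt_0_nat)
    have power: "pairing (\<lambda>k. f (x + k)) ((\<Sum>i\<in>I. ?s i) ^ p) = int (card I) ^ (p - 1)"
      using pairing_power_constant[of f a I x "p - 1", OF tile] unfolding p_Suc .
    have dilate: "pairing (\<lambda>k. f (x + k)) (\<Sum>i\<in>I. ?s i ^ p) = g x"
      by (simp add: pairing_sum frag_of_power g_def)
    have "int (card I) ^ (p - 1) - g x = int p * pairing (\<lambda>k. f (x + k)) R"
      unfolding power[symmetric] dilate[symmetric] pairing_diff[symmetric] R
      by (rule pairing_of_nat_mult)
    then have dvd: "int p dvd int (card I) ^ (p - 1) - g x"
      by simp
    have "\<not> int p dvd int (card I) ^ (p - 1)"
    proof
      assume "int p dvd int (card I) ^ (p - 1)"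
      then have "p dvd card I ^ (p - 1)"
        by (simp flip: of_nat_power)
      then have "p dvd card I"
        using p by (rule prime_dvd_power[rotated])
      then show False
        using p cop by (metis coprime_absorb_left not_prime_unit)
    qed
    then have "g x \<noteq> 0"
      using dvd by auto
    moreover have "g x \<ge> 0"
      by (simp add: g_def nonneg sum_nonneg)
    ultimately show ?thesis
      by linarith
  qed
  have "(\<Sum>x\<in>{0..<n}. g x) = (\<Sum>x\<in>{0..<n}. \<Sum>i\<in>I. f (x + a i))"
    unfolding g_def by (subst (1 2) sum_translates_period) (use n per in auto)
  also have "\<dots> = (\<Sum>x\<in>{0..<n}. 1)"
    by (simp add: tile)
  finally have sum_0: "(\<Sum>x\<in>{0..<n}. g x - 1) = 0"
    by (simp add: sum_subtractf)
  have "0 \<le> g y - 1" for y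
    using g_ge[of y] by linarith
  then have "g (x mod n) - 1 = 0"
    using n by (intro sum_nonneg_0[OF _ _ sum_0]) simp_all
  moreover have "g x = g (x mod n)"
    unfolding g_def by (intro sum.cong refl per) (simp add: cong_def mod_simps)
  ultimately show ?thesis
    by (simp add: g_def)
qed

text \<open>The dilated family satisfies the hypotheses again, so one prime factor of \<open>k\<close> can be treated
  after the other.\<close>

lemma tiling_dilate:
  fixes f :: "int \<Rightarrow> int" and a :: "'i \<Rightarrow> int"
  assumes n: "n > 0" and per: "\<And>x y. [x = y] (mod n) \<Longrightarrow> f x = f y"
    and nonneg: "\<And>x. f x \<ge> 0"
    and tile: "\<And>x. (\<Sum>i\<in>I. f (x + a i)) = 1"
    and k: "k > 0" "coprime k (card I)"
  shows "(\<Sum>i\<in>I. f (x + int k * a i)) = 1"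
  using k
proof (induction k arbitrary: x rule: prime_divisors_induct)
  case (unit k)
  then show ?case
    using tile by simp
next
  case (factor p k)
  have "(\<Sum>i\<in>I. f (x + int p * (int k * a i))) = 1" for x
    by (rule tiling_dilate_prime[OF n per nonneg]) (use factor in auto)
  then show ?case
    by (simp add: mult.assoc)
qed simp

section \<open>Factorizations with coprime factors\<close>

text \<open>Since \<open>m = |S|\<close> is coprime to \<open>|C| = l\<close>, the tiling survives the dilation of \<open>C\<close> by \<open>m\<close>. Translations
  by elements of \<open>m C\<close> preserve the class \<open>r + m \<int>\<close>, so this class is tiled by translates of its own
  intersection with \<open>S\<close>. In \<open>\<int>\<^sub>n\<close> this class has \<open>l\<close> elements, and there are \<open>l\<close> translations, so the intersection has one
  element.\<close>

lemma coprime_tiling_inj_mod: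
  fixes S C :: "int set"
  assumes nml: "n = m * l" and pos: "n > 0" and cop: "coprime m l"
    and S: "S \<subseteq> {0..<int n}" and card_S: "card S = m"
    and tile: "\<And>x. \<exists>!c. c \<in> C \<and> (x + c) mod int n \<in> S"
    and C: "finite C"
    and s: "s \<in> S" "s' \<in> S" "[s = s'] (mod int m)"
  shows "s = s'"
proof (rule ccontr)
  assume "s \<noteq> s'"
  define f :: "int \<Rightarrow> int" where "f x = of_bool (x mod int n \<in> S)" for x
  have n: "int n > 0" and m: "m > 0" and l: "l > 0"
    using pos nml by auto
  have per: "f x = f y" if "[x = y] (mod int n)" for x y
    using that by (simp add: f_def cong_def)
  have f_S: "f x = 1" if "x \<in> S" for x
    using that S by (auto simp: f_def)
  have tile': "(\<Sum>c\<in>C. f (x + c)) = 1" for x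
  proof -
    obtain c where c: "c \<in> C" "(x + c) mod int n \<in> S"
        "\<And>d. d \<in> C \<Longrightarrow> (x + d) mod int n \<in> S \<Longrightarrow> d = c"
      using tile[of x] by blast
    have "f (x + d) = 0" if "d \<in> C - {c}" for d
      using c(3)[of d] that by (auto simp: f_def)
    then have "(\<Sum>d\<in>C. f (x + d)) = (\<Sum>d\<in>{c}. f (x + d))"
      using c(1) C by (intro sum.mono_neutral_right) auto
    then show ?thesis
      using c(2) by (simp add: f_def)
  qed
  have card_C: "card C = l"
  proof -
    have "(\<Sum>x\<in>{0..<int n}. f x) = (\<Sum>x\<in>S. f x)"
      by (rule sum.mono_neutral_right) (use S in \<open>auto simp: f_def\<close>)
    also have "\<dots> = int m"
      by (simp add: f_S card_S)
    finally have sum_f: "(\<Sum>x\<in>{0..<int n}. f x) = int m" .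
    have "(\<Sum>x\<in>{0..<int n}. \<Sum>c\<in>C. f (x + c)) = int (card C) * (\<Sum>x\<in>{0..<int n}. f x)"
      using n per by (rule sum_translates_period)
    then have "int n = int (card C) * int m"
      by (simp add: tile' sum_f)
    then have "n = card C * m"
      by (simp flip: of_nat_mult)
    then show ?thesis
      using m nml by simp
  qed
  have dilated: "(\<Sum>c\<in>C. f (x + int m * c)) = 1" for x
  proof (rule tiling_dilate[where n = "int n"])
    show "0 \<le> f x" for x
      by (simp add: f_def)
  qed (use n per tile' m cop card_C in simp_all)
  \<comment> \<open>\<open>g\<close> is the restriction of \<open>f\<close> to the residue class of \<open>s\<close> modulo \<open>m\<close>, rescaled so that a
      translation by \<open>m * c\<close> becomes a translation by \<open>c\<close>\<close>
  define r where "r = s mod int m"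
  define g where "g j = f (r + int m * j)" for j
  have per_g: "g j = g j'" if "[j = j'] (mod int l)" for j j'
    unfolding g_def
  proof (rule per)
    have "[int m * j = int m * j'] (mod int m * int l)"
      using that by (simp add: cong_def flip: mult_mod_right)
    then show "[r + int m * j = r + int m * j'] (mod int n)"
      by (simp add: cong_add_lcancel nml)
  qed
  have "(\<Sum>j\<in>{0..<int l}. \<Sum>c\<in>C. g (j + c)) = int (card C) * (\<Sum>j\<in>{0..<int l}. g j)"
    by (rule sum_translates_period) (use l in simp, rule per_g)
  moreover have "(\<Sum>c\<in>C. g (j + c)) = 1" for j
    using dilated[of "r + int m * j"] by (simp add: g_def distrib_left add.assoc)
  ultimately have sum_g: "(\<Sum>j\<in>{0..<int l}. g j) = 1"
    using l card_C by simp
  have r': "r = s' mod int m"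
    using s(3) by (simp add: r_def cong_def)
  \<comment> \<open>\<open>s\<close> and \<open>s'\<close> would contribute 2 to a sum equal to 1\<close>
  define j where "j = s div int m"
  define j' where "j' = s' div int m"
  have eqs: "s = r + int m * j" "s' = r + int m * j'"
    by (simp add: r_def j_def, simp add: r' j'_def)
  have "j \<noteq> j'"
    using eqs \<open>s \<noteq> s'\<close> by auto
  have bounds: "s div int m \<in> {0..<int l}" if "s \<in> S" for s
  proof -
    have "0 \<le> s" "s < int l * int m"
      using that S by (auto simp: nml mult.commute)
    moreover have "s div int m * int m \<le> s"
      using m by (simp add: minus_mod_eq_div_mult [symmetric])
    ultimately have "s div int m * int m < int l * int m"
      by linarith
    then show ?thesis
      using \<open>0 \<le> s\<close> m by (simp add: pos_imp_zdiv_nonneg_iff)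
  qed
  have "(\<Sum>i\<in>{j, j'}. g i) \<le> (\<Sum>j\<in>{0..<int l}. g j)"
  proof (rule sum_mono2)
    show "{j, j'} \<subseteq> {0..<int l}"
      using bounds[of s] bounds[of s'] s by (simp add: j_def j'_def)
  qed (simp_all add: g_def f_def)
  moreover have "g j = 1" "g j' = 1"
    unfolding g_def eqs[symmetric] using s by (simp_all add: f_S)
  ultimately show False
    using \<open>j \<noteq> j'\<close> sum_g by simp
qed

text \<open>\<open>S\<close> has \<open>m\<close> elements and is injective modulo \<open>m\<close>, so it is a complete residue system: the
  element \<open>s\<close> with \<open>v + s\<close> divisible by \<open>m\<close> exists and is unique, and \<open>c\<close> must be \<open>v + s\<close> modulo \<open>n\<close>.\<close>

lemma multiples_tile_of_inj_mod:
  fixes S :: "int set"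
  assumes m: "m > 0" "m dvd n" and n: "n > 0"
    and S: "S \<subseteq> {0..<int n}" and card_S: "card S = m"
    and inj: "\<And>s s'. s \<in> S \<Longrightarrow> s' \<in> S \<Longrightarrow> [s = s'] (mod int m) \<Longrightarrow> s = s'"
  shows "\<exists>!c. c \<in> {c \<in> {0..<int n}. int m dvd c} \<and> (c - v) mod int n \<in> S"
proof -
  have md: "int m dvd int n"
    using m by simp
  have "(\<lambda>s. s mod int m) ` S = {0..<int m}"
  proof (rule card_subset_eq)
    have "inj_on (\<lambda>s. s mod int m) S"
      using inj by (auto simp: inj_on_def cong_def)
    then show "card ((\<lambda>s. s mod int m) ` S) = card {0..<int m}"
      by (simp add: card_image card_S)
  qed (use m in auto)
  moreover have "(- v) mod int m \<in> {0..<int m}"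
    using m by simp
  ultimately obtain s where s: "s \<in> S" "s mod int m = (- v) mod int m"
    by (metis (no_types, lifting) imageE)
  show ?thesis
  proof (rule ex1I)
    have "int m dvd v + s"
      using s(2) by (metis add.commute diff_minus_eq_add mod_eq_dvd_iff)
    then have "int m dvd (v + s) mod int n"
      using md by (simp add: dvd_mod_iff)
    moreover have "((v + s) mod int n - v) mod int n = s"
      using s(1) S n by (auto simp: mod_simps)
    ultimately show "(v + s) mod int n \<in> {c \<in> {0..<int n}. int m dvd c}
        \<and> ((v + s) mod int n - v) mod int n \<in> S"
      using s n by simp
  next
    fix c assume c: "c \<in> {c \<in> {0..<int n}. int m dvd c} \<and> (c - v) mod int n \<in> S"
    have "[(c - v) mod int n = c - v] (mod int m)"
      using md by (simp add: cong_def mod_mod_cancel)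
    also have "[c - v = 0 - v] (mod int m)"
      by (intro cong_diff) (use c in \<open>auto simp: cong_0_iff\<close>)
    also have "[0 - v = s] (mod int m)"
      using s by (simp add: cong_def)
    finally have "(c - v) mod int n = s"
      using c s inj by blast
    then have "(v + s) mod int n = c mod int n"
      by (metis add_diff_cancel_left' diff_add_cancel mod_add_right_eq)
    then show "c = (v + s) mod int n"
      using c by simp
  qed
qed

section \<open>Total perfect codes in circulant graphs\<close>

lemma total_perfect_code_circulant_iff:
  assumes n: "n > 0"
  shows "total_perfect_code (cayley_graph (integer_mod_group n) S) C \<longleftrightarrow>
    C \<subseteq> {0..<int n} \<and> (\<forall>v\<in>{0..<int n}. \<exists>!c. c \<in> C \<and> (c - v) mod int n \<in> S)"
proof -
  have arc: "v \<rightarrow>\<^bsub>cayley_graph (integer_mod_group n) S\<^esub> c \<longleftrightarrow> (c - v) mod int n \<in> S"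
    if "v \<in> {0..<int n}" "c \<in> {0..<int n}" for v c
  proof -
    have "v \<in> carrier (integer_mod_group n)" "c \<in> carrier (integer_mod_group n)"
      using that n by (auto simp: carrier_integer_mod_group)
    then show ?thesis
      by (simp add: cayley_graph_def mod_simps)
  qed
  have verts: "verts (with_proj (cayley_graph (integer_mod_group n) S)) = {0..<int n}"
    using n by (simp add: cayley_graph_def carrier_integer_mod_group)
  have "(\<exists>!c. c \<in> C \<and> v \<rightarrow>\<^bsub>cayley_graph (integer_mod_group n) S\<^esub> c) \<longleftrightarrow>
      (\<exists>!c. c \<in> C \<and> (c - v) mod int n \<in> S)"
    if "C \<subseteq> {0..<int n}" "v \<in> {0..<int n}" for v
  proof -
    have "c \<in> C \<and> v \<rightarrow>\<^bsub>cayley_graph (integer_mod_group n) S\<^esub> c \<longleftrightarrow>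
        c \<in> C \<and> (c - v) mod int n \<in> S" for c
      using arc[of v c] that by blast
    then show ?thesis
      by presburger
  qed
  then show ?thesis
    unfolding total_perfect_code_def verts by (intro conj_cong ball_cong refl)
qed

theorem theorem5p6:
  fixes n :: nat and S :: "int set"
  assumes "\<exists>p q r s k :: nat. prime p \<and> prime q \<and> prime r \<and> prime s \<and> k \<ge> 1 \<and>
      n \<in> {p ^ k, p ^ k * q, p\<^sup>2 * q\<^sup>2, p * q * r, p\<^sup>2 * q * r, p * q * r * s}"
    and "S \<subseteq> carrier (integer_mod_group n) - {0}"
    and "set_inv\<^bsub>integer_mod_group n\<^esub> S = S"
    and "generate (integer_mod_group n) S = carrier (integer_mod_group n)"
    and "card S dvd n"
    and "coprime (card S) (n div card S)"
  shows "(\<exists>C. total_perfect_code (cayley_graph (integer_mod_group n) S) C) \<longleftrightarrow>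
    (\<forall>s \<in> S. \<forall>s' \<in> S. s \<noteq> s' \<longrightarrow> \<not> [s = s'] (mod int (card S)))"
proof -
  have n: "n > 0"
    using assms(1) by (auto simp: prime_gt_0_nat)
  define m l where "m = card S" and "l = n div m"
  have nml: "n = m * l"
    using assms(5) by (simp add: m_def l_def)
  then have m: "m > 0" and l: "l > 0"
    using n by auto
  have S: "S \<subseteq> {0..<int n}"
    using assms(2) n by (auto simp: carrier_integer_mod_group)
  have "(\<exists>C. total_perfect_code (cayley_graph (integer_mod_group n) S) C) \<longleftrightarrow>
    (\<forall>s \<in> S. \<forall>s' \<in> S. [s = s'] (mod int m) \<longrightarrow> s = s')"
  proof
    assume "\<exists>C. total_perfect_code (cayley_graph (integer_mod_group n) S) C"
    then obtain C where C: "C \<subseteq> {0..<int n}"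
      and code: "\<forall>v\<in>{0..<int n}. \<exists>!c. c \<in> C \<and> (c - v) mod int n \<in> S"
      unfolding total_perfect_code_circulant_iff[OF n] by (elim exE conjE)
    \<comment> \<open>the neighbours \<open>c\<close> of the vertex \<open>- x\<close> are the \<open>c\<close> for which \<open>S - c\<close> contains \<open>x\<close>\<close>
    have tile: "\<exists>!c. c \<in> C \<and> (x + c) mod int n \<in> S" for x
    proof -
      have "(c - (- x) mod int n) mod int n = (x + c) mod int n" for c
        by (simp add: mod_simps add.commute)
      then show ?thesis
        using bspec[OF code, of "(- x) mod int n"] n by simp
    qed
    have "finite C"
      using C finite_subset by blast
    with assms(6) have "s = s'" if "s \<in> S" "s' \<in> S" "[s = s'] (mod int m)" for s s'
      by (intro coprime_tiling_inj_mod[OF nml n _ S _ tile _ that]) (simp_all add: m_def l_def)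
    then show "\<forall>s \<in> S. \<forall>s' \<in> S. [s = s'] (mod int m) \<longrightarrow> s = s'"
      by blast
  next
    assume inj: "\<forall>s \<in> S. \<forall>s' \<in> S. [s = s'] (mod int m) \<longrightarrow> s = s'"
    have "\<exists>!c. c \<in> {c \<in> {0..<int n}. int m dvd c} \<and> (c - v) mod int n \<in> S" for v
      by (rule multiples_tile_of_inj_mod) (use m n S inj assms(5) in \<open>simp_all add: m_def\<close>)
    then have "total_perfect_code (cayley_graph (integer_mod_group n) S) {c \<in> {0..<int n}. int m dvd c}"
      unfolding total_perfect_code_circulant_iff[OF n] by (intro conjI ballI) blast+
    then show "\<exists>C. total_perfect_code (cayley_graph (integer_mod_group n) S) C"
      by blast
  qed
  then show ?thesis
    unfolding m_def by blast
qed

end
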